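(* Let $\langle X,\mu\rangle$ be a measure space with $\mu(X)<\infty$. Let $f:X\to\mathbb{R}$ be a measurable function with $0\le f$ (not necessarily bounded). Let $I=(0,+\infty)$ and let $s:[I]^{<\infty}\to\mathbb{R}$ be defined as follows: for $H=\{a_1,\dots,a_n\}\in[I]^{<\infty}$ with $a_1<\dots<a_n$, put $a_0=0$, $a_{n+1}=+\infty$ and \[s(H)=\sum_{i=0}^{n}a_i\,\mu\big(f^{-1}([a_i,a_{i+1}))\big).\] Then $\mathrm{ext}(s,I)$ exists and equals $\int_X f\,d\mu\in[0,+\infty]$.
   Context: For a set $I$, $[I]^{<\infty}$ is the set of all finite subsets of $I$. A subset $K$ of a metric space $Y$ is $\delta$-dense in $Y$ if for every $x\in Y$ there is $k\in K$ with $d(k,x)<\delta$. For $0<\delta<1$, a set $K\subset(0,+\infty)$ is called $\delta$-dense in $(0,+\infty)$ if $K\cap(0,\frac1\delta)$ is $\delta$-dense in $(0,\frac1\delta)$ (usual metric). $K$ is $\delta$-sdense in $(0,+\infty)$ if there is $\delta'<\delta$ (with $0<\delta'$) such that $K$ is $\delta'$-dense in $(0,+\infty)$ in this sense. For $I=(0,+\infty)$, $s:[I]^{<\infty}\to\mathbb{R}$ and $A\in\mathbb{R}$, $\mathrm{ext}(s,I)=A$ means: for every $\epsilon>0$ there is $\delta\in(0,1)$ such that every finite $K\subset I$ that is $\delta$-sdense in $(0,+\infty)$ satisfies $|s(K)-A|<\epsilon$. Likewise $\mathrm{ext}(s,I)=+\infty$ means: for every $r\in\mathbb{N}$ there is $\delta\in(0,1)$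 such that every finite $K\subset I$ that is $\delta$-sdense in $(0,+\infty)$ satisfies $s(K)>r$. *)

theory Defs
  imports "HOL-Analysis.Analysis"
begin

definition delta_dense :: "real \<Rightarrow> 'a::metric_space set \<Rightarrow> 'a set \<Rightarrow> bool" where
  "delta_dense \<delta> K Y \<longleftrightarrow> K \<subseteq> Y \<and> (\<forall>x\<in>Y. \<exists>k\<in>K. dist k x < \<delta>)"

definition delta_dense_pos :: "real \<Rightarrow> real set \<Rightarrow> bool" where
  "delta_dense_pos \<delta> K \<longleftrightarrow>
     0 < \<delta> \<and> \<delta> < 1 \<and> K \<subseteq> {0<..} \<and> delta_dense \<delta> (K \<inter> {0<..<1/\<delta>}) {0<..<1/\<delta>}"

definition delta_sdense_pos :: "real \<Rightarrow> real set \<Rightarrow> bool" where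
  "delta_sdense_pos \<delta> K \<longleftrightarrow> (\<exists>\<delta>'. 0 < \<delta>' \<and> \<delta>' < \<delta> \<and> delta_dense_pos \<delta>' K)"

(* has_ext_pos s A means ext(s, (0,+\<infinity>)) = A.  Only the values of s on finite subsets
   of (0,+\<infinity>) matter.  The clause for -\<infinity> mirrors the one for +\<infinity>. *)
definition has_ext_pos :: "(real set \<Rightarrow> real) \<Rightarrow> ereal \<Rightarrow> bool" where
  "has_ext_pos s A \<longleftrightarrow> (case A of
      ereal a \<Rightarrow> \<forall>\<epsilon>>0. \<exists>\<delta>. 0 < \<delta> \<and> \<delta> < 1 \<and>
        (\<forall>K. finite K \<and> K \<subseteq> {0<..} \<and> delta_sdense_pos \<delta> K \<longrightarrow> \<bar>s K - a\<bar> < \<epsilon>)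
    | PInfty \<Rightarrow> \<forall>r::nat. \<exists>\<delta>. 0 < \<delta> \<and> \<delta> < 1 \<and>
        (\<forall>K. finite K \<and> K \<subseteq> {0<..} \<and> delta_sdense_pos \<delta> K \<longrightarrow> s K > real r)
    | MInfty \<Rightarrow> \<forall>r::nat. \<exists>\<delta>. 0 < \<delta> \<and> \<delta> < 1 \<and>
        (\<forall>K. finite K \<and> K \<subseteq> {0<..} \<and> delta_sdense_pos \<delta> K \<longrightarrow> s K < - real r))"

(* The list [a_0, a_1, ..., a_n, a_(n+1)] with a_0 = 0 and a_(n+1) = +\<infinity>. *)
definition levels :: "real set \<Rightarrow> ereal list" where
  "levels H = 0 # map ereal (sorted_list_of_set H) @ [\<infinity>]"

(* The summation index stops at n = card H, so real_of_ereal is applied to finite levels only. *)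
definition level_sum :: "'a measure \<Rightarrow> ('a \<Rightarrow> real) \<Rightarrow> real set \<Rightarrow> real" where
  "level_sum M f H =
     (\<Sum>i=0..card H. real_of_ereal (levels H ! i) *
        measure M (f -` {t. levels H ! i \<le> ereal t \<and> ereal t < levels H ! (i + 1)} \<inter> space M))"

end

theory Submission
  imports Defs
begin

text \<open>
  The sum \<open>s(H)\<close> is the integral of \<open>f\<close> rounded down to the nearest level in \<open>H \<union> {0}\<close>.
  If \<open>H\<close> is \<open>\<delta>\<close>-sdense, the rounding loses at most \<open>2\<delta>\<close> wherever \<open>f < 1/\<delta>\<close>, so \<open>s(H)\<close> lies
  between \<open>\<integral> f\<close> and the integral of a truncation of \<open>f - 2\<delta>\<close> that depends on \<open>\<delta>\<close> alone. As
  \<open>\<delta> \<rightarrow> 0\<close> this lower bound increases to \<open>\<integral> f\<close> by monotone convergence, whether or not the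
  integral is finite.
\<close>

section \<open>Order of the list of levels\<close>

lemma length_levels: "length (levels H) = card H + 2"
  by (simp add: levels_def)

lemma levels_0: "levels H ! 0 = 0"
  by (simp add: levels_def)

lemma levels_last: "levels H ! Suc (card H) = \<infinity>"
  by (simp add: levels_def nth_append)

text \<open>Every real in \<open>H\<close> is positive and finite, so the outer entries 0 and
  \<open>\<infinity>\<close> extend the strict order of the sorted list.\<close>

lemma sorted_levels:
  assumes "finite H" "H \<subseteq> {0<..}"
  shows "sorted_wrt (<) (levels H)"
proof -
  have "sorted_wrt (<) (map ereal (sorted_list_of_set H))"
    by (simp add: sorted_wrt_map)
  moreover have "\<forall>x\<in>set (map ereal (sorted_list_of_set H)). 0 < x \<and> x < \<infinity>"
    using assms by auto
  ultimately show ?thesis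
    by (auto simp: levels_def sorted_wrt_append)
qed

lemma levels_less:
  assumes "finite H" "H \<subseteq> {0<..}" "i < j" "j \<le> Suc (card H)"
  shows "levels H ! i < levels H ! j"
  using sorted_wrt_nth_less[OF sorted_levels[OF assms(1,2)], of i j] assms(3,4)
  by (simp add: length_levels)

lemma levels_le:
  assumes "finite H" "H \<subseteq> {0<..}" "i \<le> j" "j \<le> Suc (card H)"
  shows "levels H ! i \<le> levels H ! j"
  using levels_less[OF assms(1,2), of i j] assms(3,4) by (cases "i = j") auto

text \<open>An index up to \<open>card H\<close> lies strictly before the last entry
  \<open>\<infinity>\<close>, so \<open>real_of_ereal\<close> does not fall back on its default
  value 0 there.\<close>

lemma levels_finite:
  assumes "finite H" "H \<subseteq> {0<..}" "i \<le> card H"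
  shows "ereal (real_of_ereal (levels H ! i)) = levels H ! i"
    and "0 \<le> real_of_ereal (levels H ! i)"
proof -
  have "0 \<le> levels H ! i" using levels_le[OF assms(1,2), of 0 i] assms(3) by (simp add: levels_0)
  moreover have "levels H ! i < \<infinity>"
    using levels_less[OF assms(1,2), of i "Suc (card H)"] assms(3) by (simp add: levels_last)
  ultimately show "ereal (real_of_ereal (levels H ! i)) = levels H ! i"
    and "0 \<le> real_of_ereal (levels H ! i)"
    by (auto simp: ereal_real real_of_ereal_pos)
qed

lemma levels_mem:
  assumes "finite H" "k \<in> H"
  obtains j where "j \<le> card H" "levels H ! j = ereal k"
proof -
  have "ereal k \<in> set (map ereal (sorted_list_of_set H))" using assms by simp
  then obtain j where j: "j < card H" "map ereal (sorted_list_of_set H) ! j = ereal k"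
    by (metis in_set_conv_nth length_map length_sorted_list_of_set)
  \<comment> \<open>The leading 0 shifts positions in the sorted list by one.\<close>
  then have "levels H ! Suc j = ereal k" by (simp add: levels_def nth_append)
  with j show thesis using that[of "Suc j"] by simp
qed

section \<open>Rounding a real down to a level\<close>

definition level_set :: "real set \<Rightarrow> nat \<Rightarrow> real set" where
  "level_set H i = {t. levels H ! i \<le> ereal t \<and> ereal t < levels H ! (i + 1)}"

text \<open>Rounding down is written as a sum of indicators so that integrating it term by term
  produces \<open>level_sum\<close>.\<close>

definition level_step :: "real set \<Rightarrow> real \<Rightarrow> real" where
  "level_step H t =
     (\<Sum>i=0..card H. real_of_ereal (levels H ! i) * indicator (level_set H i) t)"

lemma level_set_borel [measurable]: "level_set H i \<in> sets borel"
  unfolding level_set_def by measurable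

text \<open>The level sets are half-open intervals between successive increasing levels, hence
  disjoint, and only the one containing \<open>t\<close> contributes.\<close>

lemma level_step_eq:
  assumes "finite H" "H \<subseteq> {0<..}" "i \<le> card H" "t \<in> level_set H i"
  shows "level_step H t = real_of_ereal (levels H ! i)"
proof -
  have "t \<notin> level_set H j" if "j \<le> card H" "j \<noteq> i" for j
  proof (cases "j < i")
    case True
    then show ?thesis
      using levels_le[OF assms(1,2), of "Suc j" i] assms(3,4) by (auto simp: level_set_def)
  next
    case False
    then show ?thesis
      using levels_le[OF assms(1,2), of "Suc i" j] assms(4) that by (auto simp: level_set_def)
  qed
  then have "level_step H t =
      (\<Sum>j=0..card H. if i = j then real_of_ereal (levels H ! j) else 0)"
    unfolding level_step_def using assms(4) by (intro sum.cong) auto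
  also have "\<dots> = real_of_ereal (levels H ! i)" using assms(3) by simp
  finally show ?thesis .
qed

lemma level_set_cover:
  assumes "0 \<le> t"
  obtains i where "i \<le> card H" "t \<in> level_set H i"
proof -
  \<comment> \<open>The index sought is the least one whose next level exceeds \<open>t\<close>. One
    exists because the last level is \<open>\<infinity>\<close>, and minimality puts level
    \<open>Least P\<close> at or below \<open>t\<close>.\<close>
  define P where "P = (\<lambda>i. ereal t < levels H ! Suc i)"
  have "P (card H)" by (simp add: P_def levels_last)
  then have le: "Least P \<le> card H" and P: "P (Least P)" by (auto intro: Least_le LeastI)
  have "levels H ! Least P \<le> ereal t"
  proof (cases "Least P")
    case 0
    then show ?thesis using assms by (simp add: levels_0)
  next
    case (Suc j)
    then have "\<not> P j" using not_less_Least[of j P] by simp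
    then show ?thesis using Suc by (simp add: P_def not_less)
  qed
  with le P show thesis using that by (simp add: P_def level_set_def)
qed

lemma level_step_bounds:
  assumes "finite H" "H \<subseteq> {0<..}" "0 \<le> t"
  shows "0 \<le> level_step H t" and "level_step H t \<le> t"
    and "\<And>k. k \<in> H \<Longrightarrow> k \<le> t \<Longrightarrow> k \<le> level_step H t"
proof -
  obtain i where i: "i \<le> card H" "t \<in> level_set H i" using level_set_cover[OF assms(3)] .
  have eq: "ereal (level_step H t) = levels H ! i"
    using level_step_eq[OF assms(1,2) i] levels_finite(1)[OF assms(1,2) i(1)] by simp
  show "0 \<le> level_step H t"
    using level_step_eq[OF assms(1,2) i] levels_finite(2)[OF assms(1,2) i(1)] by simp
  show "level_step H t \<le> t" using i(2) eq[symmetric] by (simp add: level_set_def)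
  show "k \<le> level_step H t" if k: "k \<in> H" "k \<le> t" for k
  proof -
    obtain j where j: "j \<le> card H" "levels H ! j = ereal k" using levels_mem[OF assms(1) k(1)] .
    \<comment> \<open>A level at or below \<open>t\<close> lies strictly below the upper end of the
      interval containing \<open>t\<close>, so its index is at most \<open>i\<close>.\<close>
    have "levels H ! j < levels H ! Suc i"
      using i(2) k(2) j(2) by (auto simp: level_set_def intro: le_less_trans[of "ereal k" "ereal t"])
    then have "j \<le> i" using levels_le[OF assms(1,2), of "Suc i" j] j(1) by (cases "j \<le> i") auto
    then have "ereal k \<le> ereal (level_step H t)"
      using levels_le[OF assms(1,2), of j i] i(1) j(2) eq by simp
    then show ?thesis by simp
  qed
qed

section \<open>The level sum as an integral\<close>

lemma level_sum_nonneg: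
  assumes "finite H" "H \<subseteq> {0<..}"
  shows "0 \<le> level_sum M f H"
  unfolding level_sum_def using levels_finite(2)[OF assms] by (intro sum_nonneg) simp

lemma level_sum_eq_nn_integral:
  assumes "finite_measure M" and f [measurable]: "f \<in> borel_measurable M"
    and H: "finite H" "H \<subseteq> {0<..}"
  shows "ennreal (level_sum M f H) = (\<integral>\<^sup>+x. ennreal (level_step H (f x)) \<partial>M)"
proof -
  interpret finite_measure M by fact
  define a where "a i = real_of_ereal (levels H ! i)" for i
  have a: "0 \<le> a i" if "i \<in> {0..card H}" for i
    using levels_finite(2)[OF H] that by (simp add: a_def)
  have meas: "f -` level_set H i \<inter> space M \<in> sets M" for i by measurable
  have "(\<integral>\<^sup>+x. ennreal (level_step H (f x)) \<partial>M)
      = (\<integral>\<^sup>+x. (\<Sum>i=0..card H. ennreal (a i) * indicator (f -` level_set H i \<inter> space M) x) \<partial>M)"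
  proof (intro nn_integral_cong)
    fix x assume "x \<in> space M"
    then have "level_step H (f x)
        = (\<Sum>i=0..card H. a i * indicator (f -` level_set H i \<inter> space M) x)"
      unfolding level_step_def a_def by (intro sum.cong) (auto simp: indicator_def)
    also have "ennreal \<dots>
        = (\<Sum>i=0..card H. ennreal (a i * indicator (f -` level_set H i \<inter> space M) x))"
      using a by (intro sum_ennreal[symmetric]) auto
    also have "\<dots> = (\<Sum>i=0..card H. ennreal (a i) * indicator (f -` level_set H i \<inter> space M) x)"
      by (intro sum.cong) (auto simp: indicator_def)
    finally show "ennreal (level_step H (f x))
        = (\<Sum>i=0..card H. ennreal (a i) * indicator (f -` level_set H i \<inter> space M) x)" .
  qed
  also have "\<dots> = (\<Sum>i=0..card H. ennreal (a i) * emeasure M (f -` level_set H i \<inter> space M))"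
    using meas by (subst nn_integral_sum) (simp_all del: nn_integral_indicator add: nn_integral_cmult_indicator)
  \<comment> \<open>Here finiteness of the measure enters: \<open>emeasure\<close> is the coercion
    of \<open>measure\<close>.\<close>
  also have "\<dots> = (\<Sum>i=0..card H. ennreal (a i * measure M (f -` level_set H i \<inter> space M)))"
    using a by (intro sum.cong) (simp_all add: emeasure_eq_measure ennreal_mult)
  also have "\<dots> = ennreal (\<Sum>i=0..card H. a i * measure M (f -` level_set H i \<inter> space M))"
    using a by (intro sum_ennreal) auto
  also have "\<dots> = ennreal (level_sum M f H)"
    by (simp add: level_sum_def a_def level_set_def)
  finally show ?thesis ..
qed

section \<open>A lower bound that is uniform in the finite set\<close>

text \<open>Density says nothing about points beyond the cutoff, so the bound drops to 0 there. Of
  the loss \<open>2*\<delta>\<close>, one half pays for shifting \<open>t\<close> and the other for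
  the distance to a point of \<open>K\<close>.\<close>

definition level_lower :: "real \<Rightarrow> real \<Rightarrow> real" where
  "level_lower \<delta> t = (if t < 1/\<delta> then max 0 (t - 2*\<delta>) else 0)"

text \<open>A point of \<open>K\<close> within \<open>\<delta>'\<close> of \<open>t - \<delta>'\<close> (rather than of \<open>t\<close>) is guaranteed to lie below \<open>t\<close>.\<close>

lemma level_lower_le_level_step:
  assumes "finite K" "K \<subseteq> {0<..}" "delta_sdense_pos \<delta> K" "0 \<le> t"
  shows "level_lower \<delta> t \<le> level_step K t"
proof -
  obtain d where d: "0 < d" "d < \<delta>"
    and dense: "\<And>x. x \<in> {0<..<1/d} \<Longrightarrow> \<exists>k\<in>K \<inter> {0<..<1/d}. dist k x < d"
    using assms(3) by (auto simp: delta_sdense_pos_def delta_dense_pos_def delta_dense_def)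
  note bounds = level_step_bounds[OF assms(1,2,4)]
  show ?thesis
  proof (cases "t < 1/\<delta> \<and> d < t")
    case True
    have "1/\<delta> < 1/d" using d by (simp add: frac_less2)
    with True d have "t - d \<in> {0<..<1/d}" by auto
    then obtain k where k: "k \<in> K" "dist k (t - d) < d" using dense by blast
    then have "k \<le> t" "t - 2*d \<le> k" by (auto simp: dist_real_def)
    with bounds(3)[OF k(1)] d have "t - 2*\<delta> \<le> level_step K t" by linarith
    then show ?thesis using bounds(1) by (simp add: level_lower_def)
  next
    case False
    \<comment> \<open>Either \<open>t\<close> is past the cutoff or
      \<open>t \<le> d < \<delta>\<close>; in both cases \<open>level_lower \<delta> t\<close> is
      0.\<close>
    then show ?thesis using bounds(1) d by (auto simp: level_lower_def)
  qed
qed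

text \<open>A smaller parameter raises the cutoff and reduces the loss. This supplies the
  monotonicity for monotone convergence.\<close>

lemma level_lower_mono:
  assumes "0 < \<delta>'" "\<delta>' \<le> \<delta>"
  shows "level_lower \<delta> t \<le> level_lower \<delta>' t"
proof -
  have "1/\<delta> \<le> 1/\<delta>'" using assms by (simp add: frac_le)
  then show ?thesis using assms by (auto simp: level_lower_def)
qed

text \<open>The offset 2 keeps every parameter strictly below 1, including at
  \<open>n = 0\<close>.\<close>

lemma level_lower_tendsto:
  "(\<lambda>n. level_lower (1 / real (n + 2)) t) \<longlonglongrightarrow> max 0 t"
proof -
  have lim: "(\<lambda>n. max 0 (t - 2 * (1 / real (n + 2)))) \<longlonglongrightarrow> max 0 (t - 2 * 0)"
    using LIMSEQ_ignore_initial_segment[OF lim_1_over_n, of 2] by (intro tendsto_intros) simp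
  \<comment> \<open>From \<open>N\<close> on, \<open>t\<close> is below the cutoff
    \<open>n + 2\<close>, so only the vanishing loss remains.\<close>
  obtain N :: nat where N: "t < real N" using reals_Archimedean2 by blast
  have "\<forall>\<^sub>F n in sequentially.
      max 0 (t - 2 * (1 / real (n + 2))) = level_lower (1 / real (n + 2)) t"
    using eventually_ge_at_top[of N] by eventually_elim (use N in \<open>auto simp: level_lower_def\<close>)
  from Lim_transform_eventually[OF lim this] show ?thesis by simp
qed

lemma nn_integral_level_lower_tendsto:
  assumes [measurable]: "f \<in> borel_measurable M"
  shows "(\<lambda>n. \<integral>\<^sup>+x. ennreal (level_lower (1 / real (n + 2)) (f x)) \<partial>M)
    \<longlonglongrightarrow> (\<integral>\<^sup>+x. ennreal (f x) \<partial>M)"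
proof (rule nn_integral_LIMSEQ)
  show "incseq (\<lambda>n x. ennreal (level_lower (1 / real (n + 2)) (f x)))"
    by (intro incseq_SucI le_funI ennreal_leI level_lower_mono) (auto simp: field_simps)
  show "(\<lambda>x. ennreal (level_lower (1 / real (n + 2)) (f x))) \<in> borel_measurable M" for n
    unfolding level_lower_def by measurable
  \<comment> \<open>Since \<open>ennreal\<close> sends negative reals to 0,
    \<open>max 0 (f x)\<close> and \<open>f x\<close> have the same coercion.\<close>
  show "(\<lambda>n. ennreal (level_lower (1 / real (n + 2)) (f x))) \<longlonglongrightarrow> ennreal (f x)" for x
    using tendsto_ennrealI[OF level_lower_tendsto, of "f x"] by (simp add: max_def ennreal_neg split: if_splits)
qed

section \<open>Bounds on the level sum and the limit\<close>

lemma level_sum_le: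
  assumes "finite_measure M" "f \<in> borel_measurable M" "\<And>x. x \<in> space M \<Longrightarrow> 0 \<le> f x"
    and "finite K" "K \<subseteq> {0<..}"
  shows "ereal (level_sum M f K) \<le> enn2ereal (\<integral>\<^sup>+x. ennreal (f x) \<partial>M)"
proof -
  have "ennreal (level_sum M f K) \<le> (\<integral>\<^sup>+x. ennreal (f x) \<partial>M)"
    unfolding level_sum_eq_nn_integral[OF assms(1,2,4,5)]
    using level_step_bounds(2)[OF assms(4,5) assms(3)] by (intro nn_integral_mono ennreal_leI)
  then show ?thesis
    using level_sum_nonneg[OF assms(4,5), of M f] by (simp add: less_eq_ennreal.rep_eq enn2ereal_ennreal)
qed

text \<open>Some lower integral already exceeds \<open>c\<close>, and its parameter serves as
  \<open>\<delta>\<close>. An arbitrary \<open>c\<close> below the integral covers both cases of the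
  theorem: \<open>a - \<epsilon>\<close> for a finite integral and \<open>r\<close> for an infinite
  one.\<close>

lemma level_sum_greater:
  assumes "finite_measure M" "f \<in> borel_measurable M" "\<And>x. x \<in> space M \<Longrightarrow> 0 \<le> f x"
    and c: "c < enn2ereal (\<integral>\<^sup>+x. ennreal (f x) \<partial>M)"
  obtains \<delta> where "0 < \<delta>" "\<delta> < 1"
    "\<And>K. finite K \<Longrightarrow> K \<subseteq> {0<..} \<Longrightarrow> delta_sdense_pos \<delta> K \<Longrightarrow> c < ereal (level_sum M f K)"
proof -
  have "(\<lambda>n. enn2ereal (\<integral>\<^sup>+x. ennreal (level_lower (1 / real (n + 2)) (f x)) \<partial>M))
      \<longlonglongrightarrow> enn2ereal (\<integral>\<^sup>+x. ennreal (f x) \<partial>M)"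
    using nn_integral_level_lower_tendsto[OF assms(2)] by (rule tendsto_enn2erealI)
  from order_tendstoD(1)[OF this c] obtain n where
    n: "c < enn2ereal (\<integral>\<^sup>+x. ennreal (level_lower (1 / real (n + 2)) (f x)) \<partial>M)"
    by (auto simp: eventually_sequentially)
  show thesis
  proof (rule that)
    fix K assume K: "finite K" "K \<subseteq> {0<..}" "delta_sdense_pos (1 / real (n + 2)) K"
    have "(\<integral>\<^sup>+x. ennreal (level_lower (1 / real (n + 2)) (f x)) \<partial>M) \<le> ennreal (level_sum M f K)"
      unfolding level_sum_eq_nn_integral[OF assms(1,2) K(1,2)]
      using level_lower_le_level_step[OF K assms(3)] by (intro nn_integral_mono ennreal_leI)
    then show "c < ereal (level_sum M f K)"
      using level_sum_nonneg[OF K(1,2), of M f] n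
      by (simp add: less_eq_ennreal.rep_eq enn2ereal_ennreal)
  qed auto
qed

theorem theorem6p11:
  fixes M :: "'a measure" and f :: "'a \<Rightarrow> real"
  assumes "finite_measure M"
    and "f \<in> borel_measurable M"
    and "\<And>x. x \<in> space M \<Longrightarrow> 0 \<le> f x"
  shows "has_ext_pos (level_sum M f) (enn2ereal (\<integral>\<^sup>+x. ennreal (f x) \<partial>M))"
proof (cases "enn2ereal (\<integral>\<^sup>+x. ennreal (f x) \<partial>M)")
  case (real a)
  have "\<exists>\<delta>. 0 < \<delta> \<and> \<delta> < 1 \<and> (\<forall>K. finite K \<and> K \<subseteq> {0<..} \<and> delta_sdense_pos \<delta> K \<longrightarrow>
      \<bar>level_sum M f K - a\<bar> < \<epsilon>)" if "0 < \<epsilon>" for \<epsilon> :: real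
  proof -
    have "ereal (a - \<epsilon>) < enn2ereal (\<integral>\<^sup>+x. ennreal (f x) \<partial>M)" using real that by simp
    then obtain \<delta> where \<delta>: "0 < \<delta>" "\<delta> < 1" and lower: "\<And>K. finite K \<Longrightarrow> K \<subseteq> {0<..} \<Longrightarrow>
        delta_sdense_pos \<delta> K \<Longrightarrow> ereal (a - \<epsilon>) < ereal (level_sum M f K)"
      using level_sum_greater[OF assms] by metis
    \<comment> \<open>The level sum never exceeds \<open>a\<close>, so only the lower estimate
      depends on \<open>\<delta>\<close>.\<close>
    have "\<bar>level_sum M f K - a\<bar> < \<epsilon>"
      if "finite K" "K \<subseteq> {0<..}" "delta_sdense_pos \<delta> K" for K
      using lower[OF that] level_sum_le[OF assms that(1,2)] real \<open>0 < \<epsilon>\<close> by auto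
    with \<delta> show ?thesis by blast
  qed
  with real show ?thesis by (simp add: has_ext_pos_def)
next
  case PInf
  have "\<exists>\<delta>. 0 < \<delta> \<and> \<delta> < 1 \<and> (\<forall>K. finite K \<and> K \<subseteq> {0<..} \<and> delta_sdense_pos \<delta> K \<longrightarrow>
      level_sum M f K > real r)" for r :: nat
  proof -
    have "ereal (real r) < enn2ereal (\<integral>\<^sup>+x. ennreal (f x) \<partial>M)" using PInf by simp
    then show ?thesis using level_sum_greater[OF assms] by (metis less_ereal.simps(1))
  qed
  then show ?thesis unfolding PInf has_ext_pos_def infinity_ereal_def ereal.case by blast
next
  case MInf
  then show ?thesis using enn2ereal_nonneg[of "\<integral>\<^sup>+x. ennreal (f x) \<partial>M"] by simp
qed

end
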